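(* Let $H$ be a nonzero complex Hilbert space, let $\Omega\subset H$ be a bounded domain and let $u\in\mathcal{PSH}(\Omega)\cap C^2(\overline\Omega)$ be bounded. Assume that \[ mI\le D'D''u(z)\le MI\qquad\text{for all }z\in\Omega, \] for some $0<m\le M$. Set $R^2:=\sup_{w\in\partial\Omega}\|w\|^2<\infty$ and $r^2:=\inf_{w\in\partial\Omega}\|w\|^2<\infty$. Then for all $z\in\Omega$, \[ M(\|z\|^2-R^2)+\inf_{w\in\partial\Omega}u(w)\ \le\ u(z)\ \le\ m(\|z\|^2-r^2)+\sup_{w\in\partial\Omega}u(w). \]
   Context: The inner product of $H$ is linear in the first variable; $A\ge B$ for self-adjoint operators means $\langle(A-B)x,x\rangle\ge0$ for all $x$. Plurisubharmonic: for $\Omega\subset H$ open, $\mathcal{PSH}(\Omega)$ is the set of upper semicontinuous $u:\Omega\to[-\infty,\infty)$, not identically $-\infty$ on any component of $\Omega$, such that $u(z)\le\frac1{2\pi}\int_0^{2\pi}u(z+e^{i\theta}h)\,d\theta$ whenever $z\in\Omega$, $h\in H$ and $z+\lambda h\in\Omega$ for all $|\lambda|\le1$. $C^2(\overline\Omega)$ denotes functions on $\overline\Omega$ of class $C^2$ up to the boundary (of class $C^2$ in $\Omega$, with the function and its derivatives up to order two extending continuously to $\overline\Omega$). Levi form: for a $C^2$ function $u$ with second real Fréchet differential $D^2u(a)$, $4D'D''u(a)(s,t)=D^2u(a)(s,t)+D^2u(a)(is,it)+iD^2u(a)(s,it)-iD^2u(a)(is,t)$; this form is identified with the bounded operator $D'D''u(a)$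 given by $\langle D'D''u(a)s,t\rangle=D'D''u(a)(s,t)$ (so $D'D''\|z\|^2=I$). *)

theory Defs
  imports "HOL-Analysis.Analysis"
begin

section \<open>Complex Hilbert spaces\<close>

text \<open>
  The underlying real Hilbert space carries the real inner product \<open>Re (cinner x y)\<close>, so that
  the inherited norm is the Hilbert norm \<open>sqrt (cinner x x)\<close>.
\<close>

class complex_hilbert = real_inner + complete_space +
  fixes scaleC :: "complex \<Rightarrow> 'a \<Rightarrow> 'a"  (infixr "*\<^sub>C" 75)
    and cinner :: "'a \<Rightarrow> 'a \<Rightarrow> complex"
  assumes scaleC_add_right: "c *\<^sub>C (x + y) = c *\<^sub>C x + c *\<^sub>C y"
    and scaleC_add_left: "(c + d) *\<^sub>C x = c *\<^sub>C x + d *\<^sub>C x"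
    and scaleC_scaleC: "c *\<^sub>C d *\<^sub>C x = (c * d) *\<^sub>C x"
    and scaleC_of_real: "complex_of_real r *\<^sub>C x = r *\<^sub>R x"
    and cinner_add_left: "cinner (x + y) z = cinner x z + cinner y z"
    and cinner_scaleC_left: "cinner (c *\<^sub>C x) y = c * cinner x y"
    and cinner_commute: "cinner x y = cnj (cinner y x)"
    and inner_eq_Re_cinner: "inner x y = Re (cinner x y)"

instantiation complex :: complex_hilbert
begin

definition "scaleC c (x::complex) = c * x"
definition "cinner x (y::complex) = x * cnj y"

instance
  by standard (auto simp: scaleC_complex_def cinner_complex_def algebra_simps
      inner_complex_def scaleR_conv_of_real)

end


section \<open>Plurisubharmonic functions\<close>

definition usc_on :: "'a::topological_space set \<Rightarrow> ('a \<Rightarrow> ereal) \<Rightarrow> bool" where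
  "usc_on \<Omega> u \<longleftrightarrow> (\<forall>z\<in>\<Omega>. \<forall>c. u z < c \<longrightarrow> (\<forall>\<^sub>F w in at z within \<Omega>. u w < c))"

text \<open>
  For \<open>u\<close> upper semicontinuous and \<open>< \<infinity>\<close> the positive part has a finite integral over the
  circle (\<open>e2ennreal\<close> truncates negative values to \<open>0\<close>), so the difference below is the
  integral with values in \<open>[-\<infinity>, \<infinity>)\<close>.
\<close>

definition circle_mean ::
  "('a::complex_hilbert \<Rightarrow> ereal) \<Rightarrow> 'a \<Rightarrow> 'a \<Rightarrow> ereal" where
  "circle_mean u z h =
     ereal (1 / (2 * pi)) *
       (enn2ereal (\<integral>\<^sup>+\<theta>\<in>{0..2 * pi}. e2ennreal (u (z + cis \<theta> *\<^sub>C h)) \<partial>lborel)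
      - enn2ereal (\<integral>\<^sup>+\<theta>\<in>{0..2 * pi}. e2ennreal (- u (z + cis \<theta> *\<^sub>C h)) \<partial>lborel))"

definition PSH :: "'a::complex_hilbert set \<Rightarrow> ('a \<Rightarrow> ereal) set" where
  "PSH \<Omega> = {u.
     (\<forall>z\<in>\<Omega>. u z < \<infinity>) \<and>
     usc_on \<Omega> u \<and>
     (\<forall>C\<in>components \<Omega>. \<exists>z\<in>C. u z \<noteq> - \<infinity>) \<and>
     (\<forall>z\<in>\<Omega>. \<forall>h. (\<forall>\<zeta>. cmod \<zeta> \<le> 1 \<longrightarrow> z + \<zeta> *\<^sub>C h \<in> \<Omega>) \<longrightarrow>
        u z \<le> circle_mean u z h)}"


section \<open>Functions of class \<open>C\<^sup>2\<close> up to the boundary\<close>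

text \<open>Real Frechet differentials as elements of the normed spaces of bounded linear maps.\<close>

definition fderiv ::
  "('a::real_normed_vector \<Rightarrow> 'b::real_normed_vector) \<Rightarrow> 'a \<Rightarrow> 'a \<Rightarrow>\<^sub>L 'b" where
  "fderiv f x = Blinfun (frechet_derivative f (at x))"

abbreviation fderiv2 ::
  "('a::real_normed_vector \<Rightarrow> 'b::real_normed_vector) \<Rightarrow> 'a \<Rightarrow> 'a \<Rightarrow>\<^sub>L 'a \<Rightarrow>\<^sub>L 'b" where
  "fderiv2 f \<equiv> fderiv (fderiv f)"

definition C2_on ::
  "'a::real_normed_vector set \<Rightarrow> ('a \<Rightarrow> 'b::real_normed_vector) \<Rightarrow> bool" where
  "C2_on \<Omega> f \<longleftrightarrow>
     (\<forall>x\<in>\<Omega>. f differentiable (at x)) \<and>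
     (\<forall>x\<in>\<Omega>. fderiv f differentiable (at x)) \<and>
     continuous_on \<Omega> (fderiv2 f)"

definition extends_continuously ::
  "'a::topological_space set \<Rightarrow> ('a \<Rightarrow> 'b::topological_space) \<Rightarrow> bool" where
  "extends_continuously \<Omega> f \<longleftrightarrow>
     (\<exists>g. continuous_on (closure \<Omega>) g \<and> (\<forall>x\<in>\<Omega>. g x = f x))"

text \<open>
  Here \<open>f\<close> itself is given on \<open>closure \<Omega>\<close>; its boundary values are those of its continuous
  extension. The values of \<open>f\<close> outside \<open>closure \<Omega>\<close> play no role.
\<close>

definition C2_closure ::
  "'a::real_normed_vector set \<Rightarrow> ('a \<Rightarrow> 'b::real_normed_vector) \<Rightarrow> bool" where
  "C2_closure \<Omega> f \<longleftrightarrow>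
     C2_on \<Omega> f \<and>
     continuous_on (closure \<Omega>) f \<and>
     extends_continuously \<Omega> (fderiv f) \<and>
     extends_continuously \<Omega> (fderiv2 f)"


section \<open>The Levi form and its operator\<close>

definition levi_form ::
  "('a::complex_hilbert \<Rightarrow> real) \<Rightarrow> 'a \<Rightarrow> 'a \<Rightarrow> 'a \<Rightarrow> complex" where
  "levi_form u a s t =
     (complex_of_real (fderiv2 u a s t)
      + complex_of_real (fderiv2 u a (\<i> *\<^sub>C s) (\<i> *\<^sub>C t))
      + \<i> * complex_of_real (fderiv2 u a s (\<i> *\<^sub>C t))
      - \<i> * complex_of_real (fderiv2 u a (\<i> *\<^sub>C s) t)) / 4"

text \<open>
  The type only records that the operator is bounded and real linear; complex linearity is
  inherited from the form. Existence and uniqueness are shown in \<open>levi_op_works\<close> below.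
\<close>

definition levi_op ::
  "('a::complex_hilbert \<Rightarrow> real) \<Rightarrow> 'a \<Rightarrow> 'a \<Rightarrow>\<^sub>L 'a" where
  "levi_op u a = (THE A. \<forall>s t. cinner (blinfun_apply A s) t = levi_form u a s t)"

definition op_le ::
  "('a::complex_hilbert \<Rightarrow>\<^sub>L 'a) \<Rightarrow> ('a \<Rightarrow>\<^sub>L 'a) \<Rightarrow> bool"  (infix "\<le>\<^sub>o\<^sub>p" 50) where
  "A \<le>\<^sub>o\<^sub>p B \<longleftrightarrow>
     (\<forall>x. Im (cinner ((B - A) x) x) = 0 \<and> Re (cinner ((B - A) x) x) \<ge> 0)"

lemma cinner_add_right: "cinner x (y + z) = cinner x y + cinner x (z::'a::complex_hilbert)"
  by (metis cinner_add_left cinner_commute complex_cnj_add)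

lemma cinner_scaleC_right: "cinner x (c *\<^sub>C y) = cnj c * cinner x (y::'a::complex_hilbert)"
  by (metis cinner_scaleC_left cinner_commute complex_cnj_mult)

lemma Im_cinner: "Im (cinner x y) = inner x (\<i> *\<^sub>C (y::'a::complex_hilbert))"
  by (simp add: inner_eq_Re_cinner cinner_scaleC_right)

lemma scaleC_i_i: "\<i> *\<^sub>C \<i> *\<^sub>C x = - (x::'a::complex_hilbert)"
proof -
  have "\<i> *\<^sub>C \<i> *\<^sub>C x = complex_of_real (-1) *\<^sub>C x"
    by (simp add: scaleC_scaleC)
  then show ?thesis
    by (simp only: scaleC_of_real) simp
qed

lemma norm_scaleC_i: "norm (\<i> *\<^sub>C x) = norm (x::'a::complex_hilbert)"
  by (simp add: norm_eq_sqrt_inner inner_eq_Re_cinner cinner_scaleC_left cinner_scaleC_right)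

lemma bounded_linear_scaleC_i: "bounded_linear (\<lambda>x::'a::complex_hilbert. \<i> *\<^sub>C x)"
proof (rule bounded_linear_intro[where K = 1])
  fix r :: real and x :: 'a
  show "\<i> *\<^sub>C r *\<^sub>R x = r *\<^sub>R \<i> *\<^sub>C x"
    by (metis scaleC_of_real scaleC_scaleC mult.commute)
qed (simp_all add: scaleC_add_right norm_scaleC_i)

theorem riesz_representation:
  fixes f :: "'a::{real_inner, complete_space} \<Rightarrow>\<^sub>L real"
  shows "\<exists>y. \<forall>x. f x = inner y x"
proof -
  define J where "J x = inner x x - 2 * f x" for x
  have J_lb: "J x \<ge> - (norm f)\<^sup>2" for x
  proof -
    have "f x \<le> norm f * norm x"
      using norm_blinfun[of f x] by simp
    moreover have "0 \<le> (norm x - norm f)\<^sup>2"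
      by simp
    then have "0 \<le> (norm x)\<^sup>2 + (norm f)\<^sup>2 - 2 * (norm f * norm x)"
      by (simp add: power2_diff algebra_simps)
    ultimately show ?thesis
      unfolding J_def power2_norm_eq_inner[symmetric] by linarith
  qed
  define m where "m = (INF x. J x)"
  have bdd: "bdd_below (range J)"
    using J_lb by (rule bdd_belowI2)
  have m_le: "m \<le> J x" for x
    unfolding m_def using bdd by (simp add: cINF_lower)
  have "\<exists>x. J x < m + 1 / Suc n" for n
    using cINF_less_iff[of UNIV J "m + 1 / Suc n"] bdd by (simp add: m_def)
  then obtain X where X: "J (X n) < m + 1 / Suc n" for n
    by metis
  have par: "(dist x y)\<^sup>2 = 2 * J x + 2 * J y - 4 * J ((1/2) *\<^sub>R (x + y))" for x y
    by (simp add: dist_norm power2_norm_eq_inner J_def blinfun.bilinear_simps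
        inner_simps inner_commute algebra_simps)
  have "Cauchy X"
  proof (rule metric_CauchyI)
    fix e :: real assume "e > 0"
    then obtain N where N: "4 / e\<^sup>2 < real N"
      using reals_Archimedean2 by blast
    have "dist (X i) (X j) < e" if "i \<ge> N" "j \<ge> N" for i j
    proof -
      have "1 / Suc i \<le> 1 / Suc N" "1 / Suc j \<le> 1 / Suc N"
        using that by (simp_all add: frac_le)
      then have "(dist (X i) (X j))\<^sup>2 < 4 / Suc N"
        using X[of i] X[of j] m_le[of "(1/2) *\<^sub>R (X i + X j)"] by (simp add: par)
      also have "\<dots> < e\<^sup>2"
        using N \<open>e > 0\<close> by (simp add: field_simps)
          (meson less_add_same_cancel2 less_trans zero_less_power)
      finally show ?thesis
        using \<open>e > 0\<close> by (simp add: power2_less_imp_less)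
    qed
    then show "\<exists>M. \<forall>i\<ge>M. \<forall>j\<ge>M. dist (X i) (X j) < e"
      by blast
  qed
  then obtain y where y: "X \<longlonglongrightarrow> y"
    using Cauchy_convergent_iff convergent_def by blast
  have "(\<lambda>n. J (X n)) \<longlonglongrightarrow> J y"
    unfolding J_def by (intro tendsto_intros y)
  moreover have "(\<lambda>n. m + 1 / Suc n) \<longlonglongrightarrow> m + 0"
    by (intro tendsto_intros LIMSEQ_Suc[OF lim_1_over_n])
  ultimately have "J y \<le> m"
    using X by (intro LIMSEQ_le[of "\<lambda>n. J (X n)" _ "\<lambda>n. m + 1 / Suc n"])
      (auto intro: less_imp_le)
  then have min: "J y \<le> J x" for x
    using m_le order_trans by blast
  have "f x = inner y x" for x
  proof (rule ccontr)
    assume neq: "f x \<noteq> inner y x"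
    define c where "c = f x - inner y x"
    have *: "0 \<le> t\<^sup>2 * inner x x - 2 * t * c" for t
      using min[of "y + t *\<^sub>R x"]
      by (simp add: J_def c_def blinfun.bilinear_simps inner_simps inner_commute
          algebra_simps power2_eq_square)
    define k where "k = inner x x + 1"
    have k: "k > 0" "inner x x < k"
      by (simp_all add: k_def add_nonneg_pos)
    have "c\<^sup>2 > 0"
      using neq by (simp add: c_def)
    have "(c / k)\<^sup>2 * inner x x - 2 * (c / k) * c = c\<^sup>2 / k * (inner x x / k - 2)"
      by (simp add: power2_eq_square right_diff_distrib)
    moreover have "c\<^sup>2 / k * (inner x x / k - 2) < 0"
      using k \<open>c\<^sup>2 > 0\<close> by (intro mult_pos_neg) (simp_all add: field_simps)
    ultimately show False
      using *[of "c / k"] by linarith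
  qed
  then show ?thesis
    by blast
qed

lemma cinner_eqI:
  assumes "\<And>t. cinner x t = cinner y (t::'a::complex_hilbert)"
  shows "x = y"
proof -
  have "inner x (x - y) = inner y (x - y)"
    using assms by (simp add: inner_eq_Re_cinner)
  then have "inner (x - y) (x - y) = 0"
    by (simp add: inner_diff_left)
  then show ?thesis
    by simp
qed

lemma levi_op_works:
  fixes u :: "'a::complex_hilbert \<Rightarrow> real"
  shows "cinner (levi_op u a s) t = levi_form u a s t"
    and "levi_op u a (c *\<^sub>C s) = c *\<^sub>C levi_op u a s"
proof -
  define B where "B = (\<lambda>s t. (fderiv2 u a s t + fderiv2 u a (\<i> *\<^sub>C s) (\<i> *\<^sub>C t)) / 4)"
  interpret I: bounded_linear "\<lambda>x::'a. \<i> *\<^sub>C x"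
    by (rule bounded_linear_scaleC_i)
  have B_bl: "bounded_linear (B s)" for s
    unfolding B_def
    by (intro bounded_linear_compose[OF bounded_linear_divide] bounded_linear_add
        blinfun.bounded_linear_right
        bounded_linear_compose[OF blinfun.bounded_linear_right I.bounded_linear_axioms])
  have "\<exists>y. \<forall>t. B s t = inner y t" for s
    using riesz_representation[of "Blinfun (B s)"] by (simp add: bounded_linear_Blinfun_apply B_bl)
  then obtain A where A: "B s t = inner (A s) t" for s t
    by metis
  have A_eqI: "x = y" if "\<And>t. inner x t = inner y t" for x y :: 'a
  proof -
    have "inner (x - y) (x - y) = 0"
      using that[of "x - y"] by (simp add: inner_diff_left)
    then show ?thesis
      by simp
  qed
  define K where "K = norm (fderiv2 u a)"
  have nb: "\<bar>fderiv2 u a s t\<bar> \<le> K * norm s * norm t" for s t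
  proof -
    have "\<bar>fderiv2 u a s t\<bar> \<le> norm (fderiv2 u a s) * norm t"
      using norm_blinfun[of "fderiv2 u a s" t] by simp
    also have "\<dots> \<le> K * norm s * norm t"
      unfolding K_def by (intro mult_right_mono norm_blinfun) simp
    finally show ?thesis .
  qed
  have A_bl: "bounded_linear A"
  proof (rule bounded_linear_intro[where K = K])
    show "A (x + y) = A x + A y" for x y
      by (rule A_eqI) (simp add: A[symmetric] inner_add_left, simp add: B_def
          blinfun.bilinear_simps I.add add_divide_distrib)
    show "A (r *\<^sub>R x) = r *\<^sub>R A x" for r x
      by (rule A_eqI) (simp add: A[symmetric], simp add: B_def
          blinfun.bilinear_simps I.scaleR add_divide_distrib algebra_simps)
    fix x
    have "(norm (A x))\<^sup>2 = B x (A x)"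
      by (simp add: A power2_norm_eq_inner)
    also have "\<dots> \<le> K * norm x * norm (A x)"
      using nb[of x "A x"] nb[of "\<i> *\<^sub>C x" "\<i> *\<^sub>C A x"] 
      by (simp add: B_def norm_scaleC_i)
    finally have "norm (A x) * norm (A x) \<le> norm (A x) * (norm x * K)"
      by (simp add: power2_eq_square mult_ac)
    then show "norm (A x) \<le> norm x * K"
      by (cases "norm (A x) = 0") (simp_all add: K_def)
  qed
  have rep: "cinner (A s) t = levi_form u a s t" for s t
  proof (rule complex_eqI)
    show "Re (cinner (A s) t) = Re (levi_form u a s t)"
      by (simp add: inner_eq_Re_cinner[symmetric] A[symmetric] levi_form_def B_def)
    show "Im (cinner (A s) t) = Im (levi_form u a s t)"
      by (simp add: Im_cinner A[symmetric] levi_form_def B_def scaleC_i_i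
          blinfun.bilinear_simps)
  qed
  have "\<forall>s t. cinner (levi_op u a s) t = levi_form u a s t"
    unfolding levi_op_def
  proof (rule theI[of _ "Blinfun A"])
    show "\<forall>s t. cinner (Blinfun A s) t = levi_form u a s t"
      by (simp add: bounded_linear_Blinfun_apply A_bl rep)
    fix A' :: "'a \<Rightarrow>\<^sub>L 'a"
    assume "\<forall>s t. cinner (A' s) t = levi_form u a s t"
    then show "A' = Blinfun A"
      by (intro blinfun_eqI, intro cinner_eqI[where 'a = 'a]) (simp add: bounded_linear_Blinfun_apply A_bl rep)
  qed
  then show L: "cinner (levi_op u a s) t = levi_form u a s t" for s t
    by blast
  have i: "levi_op u a (\<i> *\<^sub>C s) = \<i> *\<^sub>C levi_op u a s" for s
    by (rule cinner_eqI) (simp add: cinner_scaleC_left L, simp add: levi_form_def scaleC_i_i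
        blinfun.bilinear_simps field_simps)
  have dec: "c *\<^sub>C x = Re c *\<^sub>R x + Im c *\<^sub>R \<i> *\<^sub>C x" for x :: 'a
  proof -
    have "c *\<^sub>C x = (complex_of_real (Re c) + complex_of_real (Im c) * \<i>) *\<^sub>C x"
      by (metis complex_eq mult.commute)
    then show ?thesis
      by (simp only: scaleC_add_left scaleC_scaleC[symmetric] scaleC_of_real)
  qed
  show "levi_op u a (c *\<^sub>C s) = c *\<^sub>C levi_op u a s"
    by (simp add: dec[of s] dec[of "levi_op u a s"] blinfun.bilinear_simps i)
qed

end

theory Submission
  imports Defs
begin

text \<open>
  Both bounds are instances of one maximum principle. Write \<open>q z = (norm z)\<^sup>2\<close>. If the Levi form
  of \<open>f\<close> is bounded below by \<open>k\<close>, then \<open>f - k q\<close> has nonnegative Laplacian on every complex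
  line, so its value at a point of \<open>\<Omega>\<close> is at most its value at some boundary point \<open>w\<close>. The
  upper bound is the case \<open>f = u\<close>, \<open>k = m\<close>; the lower bound is the case \<open>f = -u\<close>, \<open>k = -M\<close>.
  Replacing \<open>q w\<close> and \<open>u w\<close> by their extrema over the boundary gives the stated inequalities.

  In infinite dimensions \<open>closure \<Omega>\<close> is not compact and a maximum over it need not be attained,
  but it is enough to work on the slice of \<open>\<Omega>\<close> by a single complex line through the given point.
  The slice is a bounded plane open set whose boundary lies in the boundary of \<open>\<Omega>\<close>, and its
  closure is compact. Adding \<open>\<epsilon> q\<close> makes the Laplacian strictly positive, which the second
  derivative test forbids at an interior maximum; then let \<open>\<epsilon>\<close> tend to \<open>0\<close>
  (\<open>perturbed_maximum_principle\<close>, \<open>levi_bound_imp_not_slice_max\<close>,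
  \<open>levi_bound_imp_le_at_frontier\<close>).
\<close>

section \<open>Maxima in finite dimensions\<close>

lemma second_deriv_nonpos_at_max:
  fixes F F' :: "real \<Rightarrow> real"
  assumes "0 < d"
    and F: "\<And>t. \<bar>t\<bar> < d \<Longrightarrow> (F has_real_derivative F' t) (at t)"
    and F': "(F' has_real_derivative c) (at 0)"
    and max: "\<And>t. \<bar>t\<bar> < d \<Longrightarrow> F t \<le> F 0"
  shows "c \<le> 0"
proof (rule ccontr)
  assume "\<not> c \<le> 0"
  then have "0 < c" by simp
  have F'0: "F' 0 = 0"
    using DERIV_local_max[OF F[of 0] \<open>0 < d\<close>] max \<open>0 < d\<close> by simp
  obtain e where e: "0 < e" "\<And>h. 0 < h \<Longrightarrow> h < e \<Longrightarrow> F' 0 < F' h"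
    using DERIV_pos_inc_right[OF F' \<open>0 < c\<close>] by auto
  define t where "t = min d e / 2"
  have t: "0 < t" "t < d" "t < e"
    using \<open>0 < d\<close> e(1) by (auto simp: t_def)
  obtain \<xi> where \<xi>: "0 < \<xi>" "\<xi> < t" "F t - F 0 = (t - 0) * F' \<xi>"
    using MVT2[of 0 t F F'] F t by force
  have "0 < F' \<xi>"
    using e(2)[of \<xi>] \<xi> t F'0 by simp
  then have "F 0 < F t"
    using \<xi>(3) t by (simp add: algebra_simps)
  then show False
    using max[of t] t by simp
qed

text \<open>
  The maximum of \<open>g + \<epsilon> q\<close> over the compact closure is attained on the frontier. There it is at
  most \<open>max g + \<epsilon> max q\<close>, where the maxima are over the frontier, and \<open>\<epsilon>\<close> is arbitrary.
\<close>

lemma perturbed_maximum_principle: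
  fixes D :: "'a::euclidean_space set" and g q :: "'a \<Rightarrow> real"
  assumes D: "open D" "bounded D" "z \<in> D"
    and g: "continuous_on (closure D) g" and q: "continuous_on (closure D) q"
    and q_nonneg: "\<And>x. 0 \<le> q x"
    and no_max: "\<And>\<epsilon> x. 0 < \<epsilon> \<Longrightarrow> x \<in> D \<Longrightarrow> \<exists>y\<in>D. g x + \<epsilon> * q x < g y + \<epsilon> * q y"
  shows "\<exists>w\<in>frontier D. g z \<le> g w"
proof -
  have clD: "compact (closure D)" and frD: "compact (frontier D)"
    using D by (auto simp: compact_closure compact_frontier_bounded)
  have sub: "frontier D \<subseteq> closure D"
    by (simp add: frontier_def)
  have "D \<noteq> UNIV"
    using D not_bounded_UNIV by blast
  then have ne: "frontier D \<noteq> {}"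
    using frontier_not_empty[of D] D by blast
  obtain w where w: "w \<in> frontier D" "\<And>y. y \<in> frontier D \<Longrightarrow> g y \<le> g w"
    using continuous_attains_sup[OF frD ne continuous_on_subset[OF g sub]] by blast
  obtain w' where w': "w' \<in> frontier D" "\<And>y. y \<in> frontier D \<Longrightarrow> q y \<le> q w'"
    using continuous_attains_sup[OF frD ne continuous_on_subset[OF q sub]] by blast
  have bound: "g z \<le> g w + \<epsilon> * q w'" if "0 < \<epsilon>" for \<epsilon>
  proof -
    have "continuous_on (closure D) (\<lambda>x. g x + \<epsilon> * q x)"
      by (intro continuous_intros g q)
    moreover have "closure D \<noteq> {}"
      using D(3) by auto
    ultimately obtain x where x: "x \<in> closure D"
      "\<And>y. y \<in> closure D \<Longrightarrow> g y + \<epsilon> * q y \<le> g x + \<epsilon> * q x"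
      using continuous_attains_sup[OF clD] by blast
    have "x \<notin> D"
    proof
      assume "x \<in> D"
      then obtain y where "y \<in> D" "g x + \<epsilon> * q x < g y + \<epsilon> * q y"
        using no_max[OF \<open>0 < \<epsilon>\<close>] by blast
      then show False
        using x(2)[of y] closure_subset[of D] by auto
    qed
    then have fr: "x \<in> frontier D"
      using x(1) D(1) by (simp add: frontier_def interior_open)
    have "g z \<le> g z + \<epsilon> * q z"
      using that q_nonneg[of z] by simp
    also have "\<dots> \<le> g x + \<epsilon> * q x"
      using x(2) D(3) closure_subset by blast
    also have "\<dots> \<le> g w + \<epsilon> * q w'"
      using w(2)[OF fr] w'(2)[OF fr] that by (intro add_mono mult_left_mono) auto
    finally show ?thesis .
  qed
  have "g z \<le> g w"
  proof (rule field_le_epsilon)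
    fix e :: real assume "0 < e"
    have q1: "0 < q w' + 1"
      using q_nonneg[of w'] by simp
    \<comment> \<open>\<open>q w'\<close> may be \<open>0\<close>, hence the \<open>+ 1\<close> in the denominator.\<close>
    have "e / (q w' + 1) * q w' \<le> e"
      using \<open>0 < e\<close> q1 by (simp add: field_simps)
    then show "g z \<le> g w + e"
      using bound[of "e / (q w' + 1)"] \<open>0 < e\<close> q1 by simp
  qed
  with w(1) show ?thesis by blast
qed

section \<open>Slices by complex lines\<close>

lemma norm_scaleC: "norm (c *\<^sub>C x) = cmod c * norm (x::'a::complex_hilbert)"
proof -
  have xx: "cinner x x = complex_of_real ((norm x)\<^sup>2)"
    using cinner_commute[of x x] inner_eq_Re_cinner[of x x]
    by (simp add: complex_eq_iff power2_norm_eq_inner)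
  have "(norm (c *\<^sub>C x))\<^sup>2 = Re (c * cnj c * cinner x x)"
    by (simp only: power2_norm_eq_inner inner_eq_Re_cinner cinner_scaleC_left cinner_scaleC_right
        mult.assoc mult.left_commute[of _ "cnj c"])
  also have "\<dots> = (cmod c * norm x)\<^sup>2"
    by (simp only: xx complex_norm_square[symmetric] of_real_mult[symmetric] Re_complex_of_real
        power_mult_distrib)
  finally show ?thesis
    by simp
qed

lemma bounded_linear_scaleC_left: "bounded_linear (\<lambda>c. c *\<^sub>C (x::'a::complex_hilbert))"
proof (rule bounded_linear_intro[where K = "norm x"])
  show "(r *\<^sub>R c) *\<^sub>C x = r *\<^sub>R c *\<^sub>C x" for r :: real and c
    by (metis scaleC_of_real scaleC_scaleC scaleR_conv_of_real)
qed (simp_all add: scaleC_add_left norm_scaleC)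

lemma has_derivative_fderiv:
  assumes "f differentiable (at x)"
  shows "(f has_derivative fderiv f x) (at x)"
proof -
  have "(f has_derivative frechet_derivative f (at x)) (at x)"
    using assms frechet_derivative_works by blast
  then show ?thesis
    by (simp add: fderiv_def bounded_linear_Blinfun_apply has_derivative_bounded_linear)
qed

lemma Re_levi_form_diag:
  "Re (levi_form u a s s) = (fderiv2 u a s s + fderiv2 u a (\<i> *\<^sub>C s) (\<i> *\<^sub>C s)) / 4"
  by (simp add: levi_form_def)

lemma levi_op_bounds:
  assumes "m *\<^sub>R id_blinfun \<le>\<^sub>o\<^sub>p levi_op u a" "levi_op u a \<le>\<^sub>o\<^sub>p M *\<^sub>R id_blinfun"
  shows "4 * m * (norm s)\<^sup>2 \<le> fderiv2 u a s s + fderiv2 u a (\<i> *\<^sub>C s) (\<i> *\<^sub>C s)"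
    and "fderiv2 u a s s + fderiv2 u a (\<i> *\<^sub>C s) (\<i> *\<^sub>C s) \<le> 4 * M * (norm s)\<^sup>2"
proof -
  have levi: "inner (levi_op u a s) s
      = (fderiv2 u a s s + fderiv2 u a (\<i> *\<^sub>C s) (\<i> *\<^sub>C s)) / 4"
    by (simp add: inner_eq_Re_cinner levi_op_works Re_levi_form_diag)
  have "0 \<le> inner ((levi_op u a - m *\<^sub>R id_blinfun) s) s"
    "0 \<le> inner ((M *\<^sub>R id_blinfun - levi_op u a) s) s"
    using assms by (auto simp: op_le_def inner_eq_Re_cinner)
  then show "4 * m * (norm s)\<^sup>2 \<le> fderiv2 u a s s + fderiv2 u a (\<i> *\<^sub>C s) (\<i> *\<^sub>C s)"
    and "fderiv2 u a s s + fderiv2 u a (\<i> *\<^sub>C s) (\<i> *\<^sub>C s) \<le> 4 * M * (norm s)\<^sup>2"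
    by (simp_all add: blinfun.bilinear_simps inner_diff_left levi power2_norm_eq_inner)
qed

lemma line_max_imp_second_deriv_le:
  fixes f :: "'a::real_inner \<Rightarrow> real" and f' :: "'a \<Rightarrow> 'a \<Rightarrow>\<^sub>L real"
    and f'' :: "'a \<Rightarrow>\<^sub>L 'a \<Rightarrow>\<^sub>L real"
  assumes "0 < d"
    and f: "\<And>t. \<bar>t\<bar> < d \<Longrightarrow> (f has_derivative f' (x + t *\<^sub>R s)) (at (x + t *\<^sub>R s))"
    and f': "(f' has_derivative f'') (at x)"
    and max: "\<And>t. \<bar>t\<bar> < d \<Longrightarrow>
      f (x + t *\<^sub>R s) - c * (norm (x + t *\<^sub>R s))\<^sup>2 \<le> f x - c * (norm x)\<^sup>2"
  shows "f'' s s \<le> 2 * c * (norm s)\<^sup>2"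
proof -
  have line: "((\<lambda>t. x + t *\<^sub>R s) has_derivative (\<lambda>h. h *\<^sub>R s)) (at t)" for t
    by (auto intro!: derivative_eq_intros)
  have sq: "(norm (x + t *\<^sub>R s))\<^sup>2
      = inner x x + 2 * t * inner x s + t\<^sup>2 * inner s s" for t :: real
    unfolding power2_norm_eq_inner
    by (simp add: inner_simps inner_commute power2_eq_square algebra_simps)
  define F where "F t = f (x + t *\<^sub>R s) - c * (norm (x + t *\<^sub>R s))\<^sup>2" for t
  define F' where "F' t = f' (x + t *\<^sub>R s) s - c * (2 * inner x s + 2 * t * inner s s)" for t
  have "(F has_real_derivative F' t) (at t)" if "\<bar>t\<bar> < d" for t
  proof -
    have "((\<lambda>t. f (x + t *\<^sub>R s)) has_derivative (\<lambda>h. f' (x + t *\<^sub>R s) (h *\<^sub>R s))) (at t)"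
      by (rule has_derivative_compose[OF line f[OF that]])
    then have D: "((\<lambda>t. f (x + t *\<^sub>R s)) has_real_derivative f' (x + t *\<^sub>R s) s) (at t)"
      by (simp add: has_field_derivative_def blinfun.scaleR_right mult.commute[of _ "f' _ _"])
    show ?thesis
      unfolding F_def F'_def sq
      by (rule derivative_eq_intros D refl | simp add: algebra_simps)+
  qed
  moreover have "(F' has_real_derivative f'' s s - 2 * c * (norm s)\<^sup>2) (at 0)"
  proof -
    have "((\<lambda>t. f' (x + t *\<^sub>R s)) has_derivative (\<lambda>h. f'' (h *\<^sub>R s))) (at 0)"
      using has_derivative_compose[OF line[of 0], of f' f''] f' by simp
    then have "((\<lambda>t. f' (x + t *\<^sub>R s) s) has_derivative (\<lambda>h. f'' (h *\<^sub>R s) s)) (at 0)"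
      by (rule bounded_linear.has_derivative[OF blinfun.bounded_linear_left])
    then have D: "((\<lambda>t. f' (x + t *\<^sub>R s) s) has_real_derivative f'' s s) (at 0)"
      by (simp add: has_field_derivative_def blinfun.bilinear_simps mult.commute[of _ "f'' _ _"])
    show ?thesis
      unfolding F'_def power2_norm_eq_inner
      by (rule derivative_eq_intros D refl | simp add: algebra_simps)+
  qed
  moreover have "F t \<le> F 0" if "\<bar>t\<bar> < d" for t
    using max[OF that] by (simp add: F_def)
  ultimately have "f'' s s - 2 * c * (norm s)\<^sup>2 \<le> 0"
    using second_deriv_nonpos_at_max[OF \<open>0 < d\<close>] by blast
  then show ?thesis by simp
qed

text \<open>
  At a maximum on the complex line \<open>x + \<complex> e\<close>, the second derivatives in the real directions \<open>e\<close>
  and \<open>\<i> e\<close> are both at most those of \<open>c q\<close>, namely \<open>2 c (norm e)\<^sup>2\<close>. Their sum is four times the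
  Levi form of \<open>f\<close> at \<open>e\<close>, which would then be at most \<open>c (norm e)\<^sup>2\<close>.
\<close>

lemma levi_bound_imp_not_slice_max:
  fixes f :: "'a::complex_hilbert \<Rightarrow> real" and f' :: "'a \<Rightarrow> 'a \<Rightarrow>\<^sub>L real"
    and f'' :: "'a \<Rightarrow>\<^sub>L 'a \<Rightarrow>\<^sub>L real"
  assumes "open \<Omega>" "x \<in> \<Omega>" "e \<noteq> 0" "c < k"
    and f: "\<And>y. y \<in> \<Omega> \<Longrightarrow> (f has_derivative f' y) (at y)"
    and f': "(f' has_derivative f'') (at x)"
    and levi: "4 * k * (norm e)\<^sup>2 \<le> f'' e e + f'' (\<i> *\<^sub>C e) (\<i> *\<^sub>C e)"
  shows "\<exists>\<zeta>. x + \<zeta> *\<^sub>C e \<in> \<Omega> \<and>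
    f x - c * (norm x)\<^sup>2 < f (x + \<zeta> *\<^sub>C e) - c * (norm (x + \<zeta> *\<^sub>C e))\<^sup>2"
proof (rule ccontr)
  assume "\<not> ?thesis"
  then have max: "f (x + \<zeta> *\<^sub>C e) - c * (norm (x + \<zeta> *\<^sub>C e))\<^sup>2 \<le> f x - c * (norm x)\<^sup>2"
    if "x + \<zeta> *\<^sub>C e \<in> \<Omega>" for \<zeta>
    using that by force
  obtain \<delta> where \<delta>: "0 < \<delta>" "ball x \<delta> \<subseteq> \<Omega>"
    using \<open>open \<Omega>\<close> \<open>x \<in> \<Omega>\<close> open_contains_ball by blast
  have dir: "f'' (\<zeta> *\<^sub>C e) (\<zeta> *\<^sub>C e) \<le> 2 * c * (norm e)\<^sup>2" if "cmod \<zeta> = 1" for \<zeta>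
  proof -
    have norm: "norm (\<zeta> *\<^sub>C e) = norm e"
      using that by (simp add: norm_scaleC)
    have seg: "x + t *\<^sub>R \<zeta> *\<^sub>C e \<in> \<Omega>" if "\<bar>t\<bar> < \<delta> / norm e" for t
      using that \<delta>(2) \<open>e \<noteq> 0\<close> by (auto simp: dist_norm norm field_simps intro!: subsetD[OF \<delta>(2)])
    have "f'' (\<zeta> *\<^sub>C e) (\<zeta> *\<^sub>C e) \<le> 2 * c * (norm (\<zeta> *\<^sub>C e))\<^sup>2"
    proof (rule line_max_imp_second_deriv_le[OF _ _ f'])
      show "0 < \<delta> / norm e"
        using \<delta>(1) \<open>e \<noteq> 0\<close> by simp
    next
      fix t assume t: "\<bar>t\<bar> < \<delta> / norm e"
      show "(f has_derivative f' (x + t *\<^sub>R \<zeta> *\<^sub>C e)) (at (x + t *\<^sub>R \<zeta> *\<^sub>C e))"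
        by (rule f[OF seg[OF t]])
      have "t *\<^sub>R \<zeta> *\<^sub>C e = (complex_of_real t * \<zeta>) *\<^sub>C e"
        by (simp only: scaleC_of_real[symmetric] scaleC_scaleC)
      then show "f (x + t *\<^sub>R \<zeta> *\<^sub>C e) - c * (norm (x + t *\<^sub>R \<zeta> *\<^sub>C e))\<^sup>2
          \<le> f x - c * (norm x)\<^sup>2"
        using max[of "complex_of_real t * \<zeta>"] seg[OF t] by simp
    qed
    then show ?thesis
      by (simp only: norm)
  qed
  have "1 *\<^sub>C e = e"
    using scaleC_of_real[of 1 e] by simp
  then have "4 * k * (norm e)\<^sup>2 \<le> 4 * c * (norm e)\<^sup>2"
    using dir[of 1] dir[of \<i>] levi by simp
  then show False
    using \<open>c < k\<close> \<open>e \<noteq> 0\<close> by simp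
qed

text \<open>
  The frontier of the slice \<open>{\<zeta>. z + \<zeta> e \<in> \<Omega>}\<close> maps into the frontier of \<open>\<Omega>\<close>, so the maximum
  principle in the plane supplies the boundary point.
\<close>

lemma levi_bound_imp_le_at_frontier:
  fixes f :: "'a::complex_hilbert \<Rightarrow> real" and f' :: "'a \<Rightarrow> 'a \<Rightarrow>\<^sub>L real"
    and f'' :: "'a \<Rightarrow> 'a \<Rightarrow>\<^sub>L 'a \<Rightarrow>\<^sub>L real"
  assumes nonzero: "\<exists>x::'a. x \<noteq> 0"
    and \<Omega>: "open \<Omega>" "bounded \<Omega>" "z \<in> \<Omega>"
    and cont: "continuous_on (closure \<Omega>) f"
    and f: "\<And>y. y \<in> \<Omega> \<Longrightarrow> (f has_derivative f' y) (at y)"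
    and f': "\<And>y. y \<in> \<Omega> \<Longrightarrow> (f' has_derivative f'' y) (at y)"
    and levi: "\<And>y s. y \<in> \<Omega> \<Longrightarrow>
      4 * k * (norm s)\<^sup>2 \<le> f'' y s s + f'' y (\<i> *\<^sub>C s) (\<i> *\<^sub>C s)"
  shows "\<exists>w\<in>frontier \<Omega>. f z - k * (norm z)\<^sup>2 \<le> f w - k * (norm w)\<^sup>2"
proof -
  obtain e :: 'a where e: "e \<noteq> 0"
    using nonzero by blast
  define p where "p \<zeta> = z + \<zeta> *\<^sub>C e" for \<zeta>
  have p_cont: "continuous_on S p" for S
    unfolding p_def
    by (intro continuous_intros linear_continuous_on bounded_linear_scaleC_left)
  define D where "D = p -` \<Omega>"
  have "open D"
    unfolding D_def using \<Omega>(1) p_cont open_vimage by blast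
  have "bounded D"
  proof -
    obtain B where B: "\<And>y. y \<in> \<Omega> \<Longrightarrow> norm y \<le> B"
      using \<Omega>(2) bounded_iff by blast
    have "cmod \<zeta> \<le> (B + norm z) / norm e" if "\<zeta> \<in> D" for \<zeta>
    proof -
      have "cmod \<zeta> * norm e = norm (p \<zeta> - z)"
        by (simp add: p_def norm_scaleC)
      also have "\<dots> \<le> B + norm z"
        using norm_triangle_ineq4[of "p \<zeta>" z] B[of "p \<zeta>"] that by (simp add: D_def)
      finally show ?thesis
        using e by (simp add: field_simps)
    qed
    then show ?thesis
      using bounded_iff by blast
  qed
  have p0: "p 0 = z"
    using scaleC_of_real[of 0 e] by (simp add: p_def)
  then have "0 \<in> D"
    using \<Omega>(3) by (simp add: D_def)
  have p_cl: "p \<zeta> \<in> closure \<Omega>" if "\<zeta> \<in> closure D" for \<zeta>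
  proof -
    have "p ` closure D \<subseteq> closure \<Omega>"
      by (rule image_closure_subset[OF p_cont])
        (use closure_subset in \<open>auto simp: D_def\<close>)
    with that show ?thesis by blast
  qed
  have p_frontier: "p \<zeta> \<in> frontier \<Omega>" if "\<zeta> \<in> frontier D" for \<zeta>
    using that p_cl \<Omega>(1) \<open>open D\<close> by (auto simp: frontier_def interior_open D_def)
  have fp_cont: "continuous_on (closure D) (\<lambda>\<zeta>. f (p \<zeta>))"
    by (rule continuous_on_compose2[OF cont p_cont]) (use p_cl in auto)
  have "\<exists>w\<in>frontier D. f (p 0) - k * (norm (p 0))\<^sup>2 \<le> f (p w) - k * (norm (p w))\<^sup>2"
  proof (rule perturbed_maximum_principle[OF \<open>open D\<close> \<open>bounded D\<close> \<open>0 \<in> D\<close>,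
        where q = "\<lambda>\<zeta>. (norm (p \<zeta>))\<^sup>2"])
    show "continuous_on (closure D) (\<lambda>\<zeta>. f (p \<zeta>) - k * (norm (p \<zeta>))\<^sup>2)"
      by (intro continuous_intros fp_cont p_cont)
    show "continuous_on (closure D) (\<lambda>\<zeta>. (norm (p \<zeta>))\<^sup>2)"
      by (intro continuous_intros p_cont)
  next
    fix \<epsilon> :: real and \<xi> assume "0 < \<epsilon>" "\<xi> \<in> D"
    then have x: "p \<xi> \<in> \<Omega>"
      by (simp add: D_def)
    have "k - \<epsilon> < k"
      using \<open>0 < \<epsilon>\<close> by simp
    then obtain \<zeta> where \<zeta>: "p \<xi> + \<zeta> *\<^sub>C e \<in> \<Omega>"
      "f (p \<xi>) - (k - \<epsilon>) * (norm (p \<xi>))\<^sup>2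
        < f (p \<xi> + \<zeta> *\<^sub>C e) - (k - \<epsilon>) * (norm (p \<xi> + \<zeta> *\<^sub>C e))\<^sup>2"
      using levi_bound_imp_not_slice_max[OF \<Omega>(1) x e _ f f'[OF x] levi[OF x]] by blast
    moreover have "p \<xi> + \<zeta> *\<^sub>C e = p (\<xi> + \<zeta>)"
      by (simp add: p_def scaleC_add_left)
    ultimately show "\<exists>\<eta>\<in>D. f (p \<xi>) - k * (norm (p \<xi>))\<^sup>2 + \<epsilon> * (norm (p \<xi>))\<^sup>2
        < f (p \<eta>) - k * (norm (p \<eta>))\<^sup>2 + \<epsilon> * (norm (p \<eta>))\<^sup>2"
      by (intro bexI[of _ "\<xi> + \<zeta>"]) (simp_all add: D_def algebra_simps)
  qed simp
  then show ?thesis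
    using p_frontier p0 by auto
qed

section \<open>The two-sided bound\<close>

theorem corollary6p5:
  fixes \<Omega> :: "'a::complex_hilbert set" and u :: "'a \<Rightarrow> real" and m M :: real
  assumes nonzero: "\<exists>x::'a. x \<noteq> 0"
    and domain: "open \<Omega>" "connected \<Omega>" "\<Omega> \<noteq> {}" "bounded \<Omega>"
    and psh: "(\<lambda>z. ereal (u z)) \<in> PSH \<Omega>"
    and C2: "C2_closure \<Omega> u"
    and bounded_u: "bounded (u ` \<Omega>)"
    and m_M: "0 < m" "m \<le> M"
    and levi: "\<And>z. z \<in> \<Omega> \<Longrightarrow>
      m *\<^sub>R id_blinfun \<le>\<^sub>o\<^sub>p levi_op u z \<and> levi_op u z \<le>\<^sub>o\<^sub>p M *\<^sub>R id_blinfun"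
  shows "let R2 = (SUP w\<in>frontier \<Omega>. ereal ((norm w)\<^sup>2));
             r2 = (INF w\<in>frontier \<Omega>. ereal ((norm w)\<^sup>2))
         in R2 < \<infinity> \<and> r2 < \<infinity> \<and>
            (\<forall>z\<in>\<Omega>.
              ereal M * (ereal ((norm z)\<^sup>2) - R2) + (INF w\<in>frontier \<Omega>. ereal (u w))
                \<le> ereal (u z) \<and>
              ereal (u z)
                \<le> ereal m * (ereal ((norm z)\<^sup>2) - r2) + (SUP w\<in>frontier \<Omega>. ereal (u w)))"
proof -
  define R2 where "R2 = (SUP w\<in>frontier \<Omega>. ereal ((norm w)\<^sup>2))"
  define r2 where "r2 = (INF w\<in>frontier \<Omega>. ereal ((norm w)\<^sup>2))"
  have cont: "continuous_on (closure \<Omega>) u"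
    using C2 by (simp add: C2_closure_def)
  have d1: "(u has_derivative fderiv u y) (at y)"
    and d2: "(fderiv u has_derivative fderiv2 u y) (at y)" if "y \<in> \<Omega>" for y
    using C2 that by (auto simp: C2_closure_def C2_on_def intro!: has_derivative_fderiv)
  have upper: "\<exists>w\<in>frontier \<Omega>. u z - m * (norm z)\<^sup>2 \<le> u w - m * (norm w)\<^sup>2"
    if "z \<in> \<Omega>" for z
  proof (rule levi_bound_imp_le_at_frontier[OF nonzero domain(1,4) that cont d1 d2])
    show "4 * m * (norm s)\<^sup>2
        \<le> fderiv2 u y s s + fderiv2 u y (\<i> *\<^sub>C s) (\<i> *\<^sub>C s)" if "y \<in> \<Omega>" for y s
      using levi[OF that] by (intro levi_op_bounds(1)) auto
  qed
  have lower: "\<exists>w\<in>frontier \<Omega>. - u z - (- M) * (norm z)\<^sup>2 \<le> - u w - (- M) * (norm w)\<^sup>2"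
    if "z \<in> \<Omega>" for z
  proof (rule levi_bound_imp_le_at_frontier[OF nonzero domain(1,4) that])
    show "continuous_on (closure \<Omega>) (\<lambda>y. - u y)"
      by (intro continuous_intros cont)
  next
    fix y assume "y \<in> \<Omega>"
    then show "((\<lambda>y. - u y) has_derivative (- fderiv u y)) (at y)"
      using has_derivative_minus[OF d1] by (simp add: uminus_blinfun.rep_eq)
    show "((\<lambda>y. - fderiv u y) has_derivative (- fderiv2 u y)) (at y)"
      using has_derivative_minus[OF d2[OF \<open>y \<in> \<Omega>\<close>]] by (simp add: uminus_blinfun.rep_eq)
    fix s
    have "fderiv2 u y s s + fderiv2 u y (\<i> *\<^sub>C s) (\<i> *\<^sub>C s) \<le> 4 * M * (norm s)\<^sup>2"
      using levi[OF \<open>y \<in> \<Omega>\<close>] by (intro levi_op_bounds(2)) auto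
    then show "4 * - M * (norm s)\<^sup>2
        \<le> (- fderiv2 u y) s s + (- fderiv2 u y) (\<i> *\<^sub>C s) (\<i> *\<^sub>C s)"
      by (simp add: uminus_blinfun.rep_eq)
  qed
  obtain B where B: "\<And>w. w \<in> closure \<Omega> \<Longrightarrow> norm w \<le> B"
    using bounded_closure[OF domain(4)] bounded_iff by blast
  have "R2 \<le> ereal (B\<^sup>2)"
    unfolding R2_def
  proof (rule SUP_least)
    fix w assume "w \<in> frontier \<Omega>"
    then have "norm w \<le> B"
      using B by (simp add: frontier_def)
    then show "ereal ((norm w)\<^sup>2) \<le> ereal (B\<^sup>2)"
      by (simp add: power_mono)
  qed
  then have R2: "R2 < \<infinity>"
    using ereal_less_PInfty le_less_trans less_ereal.simps(4) by blast
  obtain w0 where "w0 \<in> frontier \<Omega>"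
    using domain(3) upper by blast
  then have "r2 \<le> ereal ((norm w0)\<^sup>2)"
    unfolding r2_def by (rule INF_lower)
  then have r2: "r2 < \<infinity>"
    using le_less_trans less_ereal.simps(4) by blast
  have "ereal M * (ereal ((norm z)\<^sup>2) - R2) + (INF w\<in>frontier \<Omega>. ereal (u w)) \<le> ereal (u z)"
    and "ereal (u z) \<le> ereal m * (ereal ((norm z)\<^sup>2) - r2) + (SUP w\<in>frontier \<Omega>. ereal (u w))"
    if z: "z \<in> \<Omega>" for z
  proof -
    obtain w where w: "w \<in> frontier \<Omega>" "- u z - (- M) * (norm z)\<^sup>2 \<le> - u w - (- M) * (norm w)\<^sup>2"
      using lower[OF z] by blast
    have "ereal M * (ereal ((norm z)\<^sup>2) - R2) + (INF w\<in>frontier \<Omega>. ereal (u w))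
        \<le> ereal M * (ereal ((norm z)\<^sup>2) - ereal ((norm w)\<^sup>2)) + ereal (u w)"
      unfolding R2_def using m_M w(1)
      by (intro add_mono ereal_mult_left_mono ereal_minus_mono SUP_upper INF_lower) auto
    also have "\<dots> \<le> ereal (u z)"
      using w(2) by (simp add: algebra_simps)
    finally show "ereal M * (ereal ((norm z)\<^sup>2) - R2) + (INF w\<in>frontier \<Omega>. ereal (u w))
        \<le> ereal (u z)" .
    obtain w where w: "w \<in> frontier \<Omega>" "u z - m * (norm z)\<^sup>2 \<le> u w - m * (norm w)\<^sup>2"
      using upper[OF z] by blast
    have "ereal (u z) \<le> ereal m * (ereal ((norm z)\<^sup>2) - ereal ((norm w)\<^sup>2)) + ereal (u w)"
      using w(2) by (simp add: algebra_simps)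
    also have "\<dots> \<le> ereal m * (ereal ((norm z)\<^sup>2) - r2) + (SUP w\<in>frontier \<Omega>. ereal (u w))"
      unfolding r2_def using m_M w(1)
      by (intro add_mono ereal_mult_left_mono ereal_minus_mono SUP_upper INF_lower) auto
    finally show "ereal (u z)
        \<le> ereal m * (ereal ((norm z)\<^sup>2) - r2) + (SUP w\<in>frontier \<Omega>. ereal (u w))" .
  qed
  with R2 r2 show ?thesis
    by (simp add: Let_def R2_def[symmetric] r2_def[symmetric])
qed

end
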